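(* Consider the $M$-group Curie-Weiss model with homogeneous coupling matrix in the critical regime, i.e. all entries of $J$ are equal to $\beta=1$. Then $$\left(\frac{S_1}{N_1^{3/4}},\ldots,\frac{S_M}{N_M^{3/4}}\right)\Longrightarrow\mu\quad\text{as }N\to\infty,$$ where $\mu$ is a probability measure on $\mathbb{R}^M$ whose moments $m_{K_1,\ldots,K_M}(\mu)=\int x_1^{K_1}\cdots x_M^{K_M}\,\mathrm{d}\mu(x)$, for $K_1,\ldots,K_M\in\mathbb{N}_0$ and $K:=\sum_{\nu=1}^M K_\nu$, are given by $$m_{K_1,\ldots,K_M}(\mu)=12^{\frac{K}{4}}\,\frac{\Gamma\left(\frac{K+1}{4}\right)}{\Gamma\left(\frac14\right)}\,\alpha_1^{\frac{K_1}{4}}\cdots\alpha_M^{\frac{K_M}{4}}$$ if $K$ is even, and $m_{K_1,\ldots,K_M}(\mu)=0$ if $K$ is odd.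
   Context: Setting. Fix $M\in\mathbb{N}$. For each $N$ there are group sizes $N_1,\ldots,N_M\in\mathbb{N}$ with $\sum_\lambda N_\lambda=N$, and as $N\to\infty$ each $N_\lambda\to\infty$ and $N_\lambda/N\to\alpha_\lambda$, where $\alpha_\lambda\ge 0$ (possibly $0$, with $0^0=1$) and $\sum_\lambda\alpha_\lambda=1$. For a fixed positive semi-definite real symmetric $M\times M$ coupling matrix $J=(J_{\lambda\mu})$, the $M$-group Curie-Weiss model is the collection of $\{-1,1\}$-valued random variables $X_{\lambda i}$ ($1\le\lambda\le M$, $1\le i\le N_\lambda$) with $$\mathbb{P}(X_{11}=x_{11},\ldots,X_{MN_M}=x_{MN_M})=Z^{-1}\exp\Big(\frac{1}{2N}\sum_{\lambda,\mu=1}^M J_{\lambda\mu}\sum_{i=1}^{N_\lambda}\sum_{j=1}^{N_\mu}x_{\lambda i}x_{\mu j}\Big),$$ $Z$ being the normalising constant. Put $S_\lambda=\sum_{i=1}^{N_\lambda}X_{\lambda i}$. $J$ is homogeneous if all its entries equal one constant $\beta\ge0$; the critical regime is then $\beta=1$. $\Gamma$ is the Gamma function; $\Longrightarrow$ denotes weak convergence of the distributions. *)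

theory Defs
  imports "HOL-Probability.Probability"
begin

definition coupling_matrix :: "real^'m^'m \<Rightarrow> bool" where
  "coupling_matrix J \<longleftrightarrow> transpose J = J \<and> (\<forall>v. 0 \<le> v \<bullet> (J *v v))"

definition homogeneous :: "real \<Rightarrow> real^'m^'m \<Rightarrow> bool" where
  "homogeneous \<beta> J \<longleftrightarrow> 0 \<le> \<beta> \<and> (\<forall>l k. J $ l $ k = \<beta>)"

text \<open>A spin configuration assigns to the group \<open>l\<close> and the individual \<open>i \<in> {1..n l}\<close> a spin
  \<open>x l i\<close>; it is extensional in \<open>i\<close>, so that there are exactly \<open>2 ^ (\<Sum>l\<in>UNIV. n l)\<close> configurations.\<close>

definition configurations :: "('m \<Rightarrow> nat) \<Rightarrow> ('m \<Rightarrow> nat \<Rightarrow> real) set" where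
  "configurations n = (\<Pi>\<^sub>E l\<in>UNIV. {1..n l} \<rightarrow>\<^sub>E {-1, 1})"

definition cw_weight :: "real^'m^'m \<Rightarrow> ('m::finite \<Rightarrow> nat) \<Rightarrow> ('m \<Rightarrow> nat \<Rightarrow> real) \<Rightarrow> real" where
  "cw_weight J n x =
     exp (1 / (2 * real (\<Sum>l\<in>UNIV. n l)) *
       (\<Sum>l\<in>UNIV. \<Sum>k\<in>UNIV. J $ l $ k * (\<Sum>i=1..n l. \<Sum>j=1..n k. x l i * x k j)))"

definition cw_partition :: "real^'m^'m \<Rightarrow> ('m::finite \<Rightarrow> nat) \<Rightarrow> real" where
  "cw_partition J n = (\<Sum>x\<in>configurations n. cw_weight J n x)"

definition curie_weiss_model ::
  "real^'m^'m \<Rightarrow> ('m::finite \<Rightarrow> nat) \<Rightarrow> 'a measure \<Rightarrow> ('m \<Rightarrow> nat \<Rightarrow> 'a \<Rightarrow> real) \<Rightarrow> bool" where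
  "curie_weiss_model J n P X \<longleftrightarrow>
     prob_space P \<and>
     (\<forall>l. \<forall>i\<in>{1..n l}. X l i \<in> borel_measurable P \<and> (\<forall>\<omega>\<in>space P. X l i \<omega> \<in> {-1, 1})) \<and>
     (\<forall>x\<in>configurations n.
        measure P {\<omega> \<in> space P. \<forall>l. \<forall>i\<in>{1..n l}. X l i \<omega> = x l i}
          = cw_weight J n x / cw_partition J n)"

definition group_sum :: "('m \<Rightarrow> nat) \<Rightarrow> ('m \<Rightarrow> nat \<Rightarrow> 'a \<Rightarrow> real) \<Rightarrow> 'm \<Rightarrow> 'a \<Rightarrow> real" where
  "group_sum n X l \<omega> = (\<Sum>i=1..n l. X l i \<omega>)"

text \<open>The library's \<^const>\<open>weak_conv_m\<close> is defined by distribution functions and only covers measures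
  on the real line.\<close>

definition converges_weakly ::
  "(nat \<Rightarrow> 'b::topological_space measure) \<Rightarrow> 'b measure \<Rightarrow> bool" where
  "converges_weakly M \<mu> \<longleftrightarrow>
     (\<forall>f::'b \<Rightarrow> real. continuous_on UNIV f \<and> bounded (range f) \<longrightarrow>
        (\<lambda>n. integral\<^sup>L (M n) f) \<longlonglongrightarrow> integral\<^sup>L \<mu> f)"

definition moment :: "(real^'m::finite) measure \<Rightarrow> ('m \<Rightarrow> nat) \<Rightarrow> real" where
  "moment \<mu> K = (\<integral>x. (\<Prod>l\<in>UNIV. (x $ l) ^ K l) \<partial>\<mu>)"

text \<open>The library has \<open>0 powr 0 = 0\<close>, whereas the moment formula needs \<open>0\<^sup>0 = 1\<close>.\<close>

definition pow0 :: "real \<Rightarrow> real \<Rightarrow> real" where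
  "pow0 a s = (if s = 0 then 1 else a powr s)"

end

theory Submission
  imports Defs "HOL-Real_Asymp.Real_Asymp"
begin

text \<open>Since the interaction depends only on the square of the total spin, a Gaussian integral over an
  auxiliary field \<open>y\<close> linearises it: after the rescaling \<open>t = y / N powr (1/4)\<close>, the model is a mixture
  over \<open>y\<close> of measures under which all spins are independent with mean \<open>tanh t\<close>, and the mixing
  weight is \<open>exp (- N (t\<^sup>2 / 2 - ln (cosh t)))\<close>. At criticality the quadratic terms cancel, so this weight tends
  to \<open>exp (- y ^ 4 / 12)\<close>; the bound \<open>tanh t \<ge> t / (1 + t)\<close> dominates it by a Gaussian. For fixed \<open>y\<close>,
  Chebyshev's inequality concentrates the group sum \<open>S\<^sub>l / N\<^sub>l powr (3/4)\<close> at \<open>\<alpha>\<^sub>l powr (1/4) * y\<close>. Hence the limit is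
  the image of the law with density proportional to \<open>exp (- y ^ 4 / 12)\<close> on the line spanned by the vector of the
  \<open>\<alpha>\<^sub>l powr (1/4)\<close>, and its moments are Gamma integrals.\<close>

section \<open>Lower bounds for the rate function \<open>t\<^sup>2 / 2 - ln (cosh t)\<close>\<close>

text \<open>Clearing denominators reduces this to \<open>1 + 2 * t \<le> exp (2 * t)\<close>. The
  lower bound has the same slope at 0 as \<open>tanh\<close>, so integrating its square twice keeps
  the sharp quartic constant 1/12 near 0.\<close>

lemma tanh_ge_nonneg:
  fixes t :: real
  assumes "t \<ge> 0"
  shows "t / (1 + t) \<le> tanh t"
proof -
  have "1 + 2 * t \<le> exp (2 * t)" by (rule exp_ge_add_one_self)
  moreover have "exp (2 * t) = exp t * exp t" by (simp flip: exp_add)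
  ultimately have "(1 + 2 * t) * exp (- t) \<le> exp t * (exp t * exp (- t))"
    by (metis exp_ge_zero mult.assoc mult_right_mono)
  then have "(1 + 2 * t) * exp (- t) \<le> exp t" by (simp flip: exp_add)
  then have "t * (exp t + exp (- t)) \<le> (1 + t) * (exp t - exp (- t))"
    by (simp add: algebra_simps)
  then have "t * cosh t \<le> (1 + t) * sinh t"
    by (simp add: cosh_field_def sinh_field_def)
  then show ?thesis using assms by (simp add: tanh_def field_simps)
qed

text \<open>The derivative of the rate function is \<open>t - tanh t\<close>, and the derivative of
  that is \<open>(tanh t)\<^sup>2\<close>. The bound on \<open>tanh\<close> is therefore integrated
  twice from 0, first for the slope and then for the function.\<close>

lemma rate_function_ge_nonneg:
  fixes t :: real
  assumes "t \<ge> 0"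
  shows "t ^ 4 / (12 * (1 + t)\<^sup>2) \<le> t\<^sup>2 / 2 - ln (cosh t)"
proof -
  \<comment> \<open>The factor \<open>1 / (1 + r)\<close> is frozen at its smallest value on the
    interval from 0 to \<open>t\<close>, which makes the comparison functions plain powers of
    \<open>r\<close>.\<close>
  define c where "c = 1 / (1 + t)\<^sup>2"
  have slope: "c * s ^ 3 / 3 \<le> s - tanh s" if s: "0 \<le> s" "s \<le> t" for s
  proof -
    have "(\<lambda>r. r - tanh r - c * r ^ 3 / 3) 0 \<le> (\<lambda>r. r - tanh r - c * r ^ 3 / 3) s"
    proof (rule DERIV_nonneg_imp_nondecreasing[OF s(1)])
      fix r assume r: "0 \<le> r" "r \<le> s"
      have "r / (1 + t) \<le> r / (1 + r)"
        using r s by (intro divide_left_mono) auto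
      also have "\<dots> \<le> tanh r" by (rule tanh_ge_nonneg[OF r(1)])
      finally have "(r / (1 + t))\<^sup>2 \<le> (tanh r)\<^sup>2"
        using r s by (intro power_mono) auto
      then have le: "0 \<le> (tanh r)\<^sup>2 - c * r\<^sup>2" by (simp add: power_divide c_def)
      show "\<exists>y. ((\<lambda>r. r - tanh r - c * r ^ 3 / 3) has_real_derivative y) (at r) \<and> 0 \<le> y"
        using le
        by (intro exI[of _ "(tanh r)\<^sup>2 - c * r\<^sup>2"] conjI) (auto intro!: derivative_eq_intros)
    qed
    then show ?thesis by simp
  qed
  have "(\<lambda>r. r\<^sup>2 / 2 - ln (cosh r) - c * r ^ 4 / 12) 0
    \<le> (\<lambda>r. r\<^sup>2 / 2 - ln (cosh r) - c * r ^ 4 / 12) t"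
  proof (rule DERIV_nonneg_imp_nondecreasing[OF assms])
    fix r assume r: "0 \<le> r" "r \<le> t"
    show "\<exists>y. ((\<lambda>r. r\<^sup>2 / 2 - ln (cosh r) - c * r ^ 4 / 12) has_real_derivative y) (at r) \<and> 0 \<le> y"
      using slope[OF r]
      by (intro exI[of _ "r - tanh r - c * r ^ 3 / 3"] conjI)
         (auto intro!: derivative_eq_intros simp: tanh_def)
  qed
  then show ?thesis by (simp add: c_def)
qed

lemma rate_function_ge:
  "t ^ 4 / (12 * (1 + \<bar>t\<bar>)\<^sup>2) \<le> t\<^sup>2 / 2 - ln (cosh (t::real))"
  using rate_function_ge_nonneg[of "\<bar>t\<bar>"] by (cases "t \<ge> 0") auto

text \<open>For \<open>\<bar>y\<bar> \<ge> 1\<close> the denominator is at most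
  \<open>(2 * \<bar>y\<bar>)\<^sup>2\<close>; otherwise the left side is negative. This trades the
  quartic quotient for a quadratic exponent, hence for a Gaussian.\<close>

lemma quartic_ratio_ge: "y\<^sup>2 / 4 - 1 \<le> y ^ 4 / (1 + \<bar>y\<bar>)\<^sup>2" for y :: real
proof (cases "\<bar>y\<bar> \<ge> 1")
  case True
  then have "(1 + \<bar>y\<bar>)\<^sup>2 \<le> (2 * \<bar>y\<bar>)\<^sup>2" by (intro power_mono) auto
  then have "y ^ 4 / (2 * \<bar>y\<bar>)\<^sup>2 \<le> y ^ 4 / (1 + \<bar>y\<bar>)\<^sup>2"
    using True by (intro divide_left_mono) auto
  moreover have "y ^ 4 / (2 * \<bar>y\<bar>)\<^sup>2 = y\<^sup>2 / 4"
    using True by (simp add: power_mult_distrib power4_eq_xxxx power2_eq_square)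
  ultimately show ?thesis by simp
next
  case False
  then have "y\<^sup>2 \<le> 1" by (simp add: abs_square_le_1)
  then have "y\<^sup>2 / 4 - 1 \<le> 0" by simp
  also have "0 \<le> y ^ 4 / (1 + \<bar>y\<bar>)\<^sup>2" by (simp add: zero_le_even_power)
  finally show ?thesis .
qed

section \<open>The mixing weight: uniform Gaussian bound and pointwise limit\<close>

text \<open>With \<open>t = y / N powr (1/4)\<close>, the first factor is the Gaussian weight
  \<open>exp (- N * t\<^sup>2 / 2)\<close>; the second is, up to \<open>2 ^ N\<close>, the
  normalising factor of \<open>N\<close> independent spins in the field \<open>t\<close>.\<close>

definition mixing_weight :: "nat \<Rightarrow> real \<Rightarrow> real" where
  "mixing_weight N y = exp (- (sqrt (real N) * y\<^sup>2 / 2)) * cosh (y / real N powr (1/4)) ^ N"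

lemma mixing_weight_pos: "0 < mixing_weight N y"
  by (simp add: mixing_weight_def)

lemma mixing_weight_conv_rate:
  assumes "N > 0"
  shows "mixing_weight N y
    = exp (- (real N * ((y / real N powr (1/4))\<^sup>2 / 2 - ln (cosh (y / real N powr (1/4))))))"
proof -
  have *: "(real N powr (1/4))\<^sup>2 = sqrt (real N)"
    using assms by (simp add: powr_half_sqrt[symmetric] powr_power)
  have "real N * ((y / real N powr (1/4))\<^sup>2 / 2) = sqrt (real N) * y\<^sup>2 / 2"
    using assms by (simp add: power_divide * field_simps flip: real_sqrt_mult)
  moreover have "cosh (y / real N powr (1/4)) ^ N = exp (real N * ln (cosh (y / real N powr (1/4))))"
    by (simp add: exp_of_nat_mult)
  ultimately show ?thesis
    by (simp add: mixing_weight_def right_diff_distrib flip: exp_add)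
qed

text \<open>Since \<open>a \<ge> 1\<close>, replacing \<open>y / a\<close> by \<open>y\<close> in
  the denominator only lowers the bound, and the prefactor \<open>N = a ^ 4\<close> cancels the
  rescaling of the numerator. What remains is free of \<open>N\<close>; the constants are those of
  \<open>quartic_ratio_ge\<close> divided by 12.\<close>

lemma mixing_weight_le:
  assumes "N > 0"
  shows "mixing_weight N y \<le> exp (1/12 - y\<^sup>2 / 48)"
proof -
  define a where "a = real N powr (1/4)"
  have a: "a \<ge> 1" "a ^ 4 = real N"
    using assms by (simp_all add: a_def powr_power ge_one_powr_ge_zero)
  have "(1 + \<bar>y / a\<bar>)\<^sup>2 \<le> (1 + \<bar>y\<bar>)\<^sup>2"
    using a by (intro power_mono) (auto simp: abs_divide divide_le_eq mult_le_cancel_left1)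
  then have "y ^ 4 / (12 * (1 + \<bar>y\<bar>)\<^sup>2) \<le> y ^ 4 / (12 * (1 + \<bar>y / a\<bar>)\<^sup>2)"
    by (intro divide_left_mono) (auto simp: zero_le_even_power add_nonneg_eq_0_iff)
  also have "\<dots> = real N * ((y / a) ^ 4 / (12 * (1 + \<bar>y / a\<bar>)\<^sup>2))"
    using a assms by (simp add: power_divide flip: a(2))
  also have "\<dots> \<le> real N * ((y / a)\<^sup>2 / 2 - ln (cosh (y / a)))"
    by (intro mult_left_mono rate_function_ge) auto
  finally have "y ^ 4 / (12 * (1 + \<bar>y\<bar>)\<^sup>2) \<le> real N * ((y / a)\<^sup>2 / 2 - ln (cosh (y / a)))" .
  moreover have "y ^ 4 / (12 * (1 + \<bar>y\<bar>)\<^sup>2) = (y ^ 4 / (1 + \<bar>y\<bar>)\<^sup>2) / 12" by simp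
  ultimately show ?thesis
    using quartic_ratio_ge[of y] unfolding mixing_weight_conv_rate[OF assms] a_def[symmetric]
    by simp
qed

text \<open>This is the expansion ln (cosh t) = t^2/2 - t^4/12 + O(t^6), with the quadratic terms
  cancelling.\<close>

lemma rate_function_quartic:
  "((\<lambda>t::real. (t\<^sup>2 / 2 - ln (cosh t)) / t ^ 4) \<longlongrightarrow> 1 / 12) (at 0)"
  unfolding cosh_field_def by real_asymp

text \<open>For \<open>t = y / N powr (1/4)\<close> one has \<open>N * t ^ 4 = y ^ 4\<close>, so the
  exponent is \<open>- (y ^ 4)\<close> times the quotient in \<open>rate_function_quartic\<close>.
  That limit is a punctured one, so \<open>y = 0\<close>, where every weight is 1, is treated
  separately.\<close>

lemma mixing_weight_tendsto:
  "(\<lambda>N. mixing_weight N y) \<longlonglongrightarrow> exp (- (y ^ 4 / 12))"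
proof (cases "y = 0")
  case True
  then show ?thesis by (simp add: mixing_weight_def)
next
  case False
  have "(\<lambda>N. y / real N powr (1/4)) \<longlonglongrightarrow> 0" by real_asymp
  moreover have "\<forall>\<^sub>F N in sequentially. y / real N powr (1/4) \<noteq> 0"
    using eventually_gt_at_top[of 0] by eventually_elim (use False in auto)
  ultimately have "filterlim (\<lambda>N. y / real N powr (1/4)) (at 0) sequentially"
    by (simp add: filterlim_at)
  from filterlim_compose[OF rate_function_quartic this]
  have "(\<lambda>N. exp (- (y ^ 4 * (((y / real N powr (1/4))\<^sup>2 / 2 - ln (cosh (y / real N powr (1/4))))
      / (y / real N powr (1/4)) ^ 4)))) \<longlonglongrightarrow> exp (- (y ^ 4 * (1 / 12)))"
    by (intro tendsto_exp tendsto_minus tendsto_mult_left)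
  moreover have "\<forall>\<^sub>F N in sequentially. exp (- (y ^ 4 * (((y / real N powr (1/4))\<^sup>2 / 2
      - ln (cosh (y / real N powr (1/4)))) / (y / real N powr (1/4)) ^ 4))) = mixing_weight N y"
    using eventually_gt_at_top[of 0]
  proof eventually_elim
    case (elim N)
    have "(real N powr (1/4)) ^ 4 = real N" using elim by (simp add: powr_power)
    then have "y ^ 4 * (c / (y / real N powr (1/4)) ^ 4) = real N * c" for c
      using False by (simp add: power_divide)
    then show ?case using elim by (simp add: mixing_weight_conv_rate)
  qed
  ultimately have "(\<lambda>N. mixing_weight N y) \<longlonglongrightarrow> exp (- (y ^ 4 * (1 / 12)))"
    by (rule Lim_transform_eventually)
  then show ?thesis by simp
qed

section \<open>Independent spins in an external field\<close>

lemma finite_configurations: "finite (configurations (n :: 'm::finite \<Rightarrow> nat))"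
  by (auto simp: configurations_def intro!: finite_PiE)

text \<open>The distributive law is applied twice, inside each group and then over the groups,
  following the nested \<open>PiE\<close> of \<open>configurations\<close>. It expresses
  independence for finite sums.\<close>

lemma sum_configurations_prod:
  fixes h :: "'m::finite \<Rightarrow> nat \<Rightarrow> real \<Rightarrow> real"
  shows "(\<Sum>x\<in>configurations n. \<Prod>l\<in>UNIV. \<Prod>i=1..n l. h l i (x l i))
    = (\<Prod>l\<in>UNIV. \<Prod>i=1..n l. h l i (-1) + h l i 1)"
proof -
  have "(\<Prod>l\<in>UNIV. \<Prod>i=1..n l. h l i (-1) + h l i 1)
    = (\<Prod>l\<in>UNIV. \<Prod>i=1..n l. \<Sum>s\<in>{-1, 1}. h l i s)" by simp
  also have "\<dots> = (\<Prod>l\<in>UNIV. \<Sum>z\<in>{1..n l} \<rightarrow>\<^sub>E {-1, 1}. \<Prod>i=1..n l. h l i (z i))"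
    by (intro prod.cong refl prod_sum_PiE) auto
  also have "\<dots> = (\<Sum>x\<in>configurations n. \<Prod>l\<in>UNIV. \<Prod>i=1..n l. h l i (x l i))"
    unfolding configurations_def by (intro prod_sum_PiE) (auto intro!: finite_PiE)
  finally show ?thesis by simp
qed

text \<open>The law of a single spin in the field \<open>t\<close>; its mean is
  \<open>tanh t\<close>.\<close>

definition spin_prob :: "real \<Rightarrow> real \<Rightarrow> real" where
  "spin_prob t s = exp (t * s) / (2 * cosh t)"

text \<open>A mass function on \<open>configurations\<close> rather than a product measure, so that
  all expectations are finite sums.\<close>

definition tilted :: "real \<Rightarrow> ('m::finite \<Rightarrow> nat) \<Rightarrow> ('m \<Rightarrow> nat \<Rightarrow> real) \<Rightarrow> real" where
  "tilted t n x = (\<Prod>l\<in>UNIV. \<Prod>i=1..n l. spin_prob t (x l i))"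

lemma tilted_nonneg: "0 \<le> tilted t n x"
  by (auto simp: tilted_def spin_prob_def intro!: prod_nonneg)

lemma spin_prob_total: "spin_prob t (-1) + spin_prob t 1 = 1"
proof -
  have "2 * cosh t = exp (- t) + exp t" "exp (- t) + exp t > 0"
    by (simp_all add: cosh_field_def add_pos_pos)
  then show ?thesis by (simp add: spin_prob_def flip: add_divide_distrib)
qed

lemma spin_prob_centered:
  "spin_prob t (-1) * (-1 - tanh t) + spin_prob t 1 * (1 - tanh t) = 0"
proof -
  have e: "exp (t * 1) = cosh t + sinh t" "exp (t * (-1)) = cosh t - sinh t"
    by (simp_all add: cosh_plus_sinh cosh_minus_sinh)
  show ?thesis unfolding spin_prob_def e tanh_def by (simp add: field_simps)
qed

text \<open>The variance equals \<open>1 - (tanh t)\<^sup>2\<close>; the bound 1 is uniform in the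
  field.\<close>

lemma spin_prob_variance_le:
  "spin_prob t (-1) * (-1 - tanh t)\<^sup>2 + spin_prob t 1 * (1 - tanh t)\<^sup>2 \<le> 1"
proof -
  define p q m where "p = spin_prob t (-1)" "q = spin_prob t 1" "m = tanh t"
  have pq: "p + q = 1" and c: "p * (-1 - m) + q * (1 - m) = 0"
    using spin_prob_total[of t] spin_prob_centered[of t] by (simp_all add: p_q_m_def)
  have m: "m = q - p" using pq c by algebra
  have "p * (-1 - m)\<^sup>2 + q * (1 - m)\<^sup>2 = 1 - m\<^sup>2"
    using pq m by algebra
  then show ?thesis by (simp add: p_q_m_def)
qed

lemma sum_tilted: "(\<Sum>x\<in>configurations n. tilted t n x) = 1"
  unfolding tilted_def by (subst sum_configurations_prod) (simp add: spin_prob_total)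

text \<open>The covariance of two spins of one group. The summand is still a product over all spins,
  so the sum factorises: untouched spins contribute 1, and for \<open>i \<noteq> j\<close> a centred
  factor contributes 0.\<close>

lemma sum_tilted_insert_factors:
  fixes n :: "'m::finite \<Rightarrow> nat"
  assumes "i \<in> {1..n k}" "j \<in> {1..n k}"
  shows "(\<Sum>x\<in>configurations n. tilted t n x * ((x k i - tanh t) * (x k j - tanh t)))
    = (if i = j then spin_prob t (-1) * (-1 - tanh t)\<^sup>2 + spin_prob t 1 * (1 - tanh t)\<^sup>2 else 0)"
proof -
  \<comment> \<open>A single deviation is written as a product over all spins, equal to 1 away from
    its own index. For \<open>i = j\<close> both deviations sit at the same index and give the
    square.\<close>
  let ?d = "\<lambda>l r j' s. if l = k \<and> r = j' then s - tanh t else 1"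
  define h where "h = (\<lambda>l r s. spin_prob t s * (?d l r i s * ?d l r j s))"
  have single: "(\<Prod>l\<in>UNIV. \<Prod>r=1..n l. ?d l r j' (x l r)) = x k j' - tanh t"
    if "j' \<in> {1..n k}" for j' and x :: "'m \<Rightarrow> nat \<Rightarrow> real"
  proof -
    have "(\<Prod>r=1..n l. ?d l r j' (x l r)) = (if l = k then x k j' - tanh t else 1)" for l
      using that by (cases "l = k") (auto simp: prod.delta)
    then show ?thesis by simp
  qed
  have "tilted t n x * ((x k i - tanh t) * (x k j - tanh t)) = (\<Prod>l\<in>UNIV. \<Prod>r=1..n l. h l r (x l r))"
    for x
    unfolding tilted_def h_def prod.distrib
    by (simp only: single[OF assms(1)] single[OF assms(2)])
  then have "(\<Sum>x\<in>configurations n. tilted t n x * ((x k i - tanh t) * (x k j - tanh t)))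
    = (\<Prod>l\<in>UNIV. \<Prod>r=1..n l. h l r (-1) + h l r 1)"
    by (simp only: sum_configurations_prod)
  also have "\<dots> = (\<Prod>l\<in>UNIV. if l = k then \<Prod>r=1..n k. h k r (-1) + h k r 1 else 1)"
    by (intro prod.cong) (auto simp: h_def spin_prob_total)
  also have "\<dots> = (\<Prod>r=1..n k. h k r (-1) + h k r 1)" by simp
  also have "\<dots> = (if i = j then spin_prob t (-1) * (-1 - tanh t)\<^sup>2
      + spin_prob t 1 * (1 - tanh t)\<^sup>2 else 0)"
  proof (cases "i = j")
    case True
    have "(\<Prod>r=1..n k. h k r (-1) + h k r 1) = (\<Prod>r=1..n k. if r = i then
        spin_prob t (-1) * (-1 - tanh t)\<^sup>2 + spin_prob t 1 * (1 - tanh t)\<^sup>2 else 1)"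
      using True by (intro prod.cong) (auto simp: h_def spin_prob_total power2_eq_square)
    then show ?thesis using True assms by (simp add: prod.delta)
  next
    case False
    then have "h k i (-1) + h k i 1 = 0"
      using spin_prob_centered[of t] by (simp add: h_def)
    then have "(\<Prod>r=1..n k. h k r (-1) + h k r 1) = 0"
      using assms(1) by (intro prod_zero) auto
    then show ?thesis using False by simp
  qed
  finally show ?thesis .
qed

text \<open>Expanding the square leaves only the diagonal covariances, so the variances of the
  \<open>n k\<close> spins add up.\<close>

lemma tilted_variance_le:
  "(\<Sum>x\<in>configurations n. tilted t n x * ((\<Sum>i=1..n k. x k i) - real (n k) * tanh t)\<^sup>2) \<le> real (n k)"
proof -
  define v where "v = spin_prob t (-1) * (-1 - tanh t)\<^sup>2 + spin_prob t 1 * (1 - tanh t)\<^sup>2"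
  have "((\<Sum>i=1..n k. x k i) - real (n k) * tanh t)\<^sup>2
      = (\<Sum>i=1..n k. \<Sum>j=1..n k. (x k i - tanh t) * (x k j - tanh t))" for x :: "'a \<Rightarrow> nat \<Rightarrow> real"
    by (simp add: power2_eq_square sum_subtractf flip: sum_product)
  then have "(\<Sum>x\<in>configurations n. tilted t n x * ((\<Sum>i=1..n k. x k i) - real (n k) * tanh t)\<^sup>2)
    = (\<Sum>x\<in>configurations n. \<Sum>i=1..n k. \<Sum>j=1..n k.
        tilted t n x * ((x k i - tanh t) * (x k j - tanh t)))"
    by (simp add: sum_distrib_left)
  also have "\<dots> = (\<Sum>i=1..n k. \<Sum>j=1..n k. \<Sum>x\<in>configurations n.
        tilted t n x * ((x k i - tanh t) * (x k j - tanh t)))"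
    by (subst sum.swap, intro sum.cong refl, rule sum.swap)
  also have "\<dots> = (\<Sum>i=1..n k. \<Sum>j=1..n k. if i = j then v else 0)"
    unfolding v_def by (intro sum.cong refl sum_tilted_insert_factors)
  also have "\<dots> = real (n k) * v" by simp
  also have "\<dots> \<le> real (n k) * 1"
    unfolding v_def by (intro mult_left_mono spin_prob_variance_le) auto
  finally show ?thesis by simp
qed

section \<open>Concentration of the scaled group sums\<close>

text \<open>Taking a configuration as argument lets one function serve both the finite sums and, at
  the realised spins, the random vector.\<close>

definition scaled_sums :: "('m::finite \<Rightarrow> nat) \<Rightarrow> ('m \<Rightarrow> nat \<Rightarrow> real) \<Rightarrow> real^'m" where
  "scaled_sums n x = (\<chi> l. (\<Sum>i=1..n l. x l i) / real (n l) powr (3 / 4))"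

text \<open>The deviation from \<open>c\<close> splits into a fluctuation around the mean and a
  bias, and \<open>(u + w)\<^sup>2 \<le> 2 * u\<^sup>2 + 2 * w\<^sup>2\<close> separates them. The
  scaling by the power 3/4 leaves a variance of order \<open>n l powr (- 1/2)\<close>.\<close>

lemma tilted_deviation_le:
  fixes n :: "'m::finite \<Rightarrow> nat"
  assumes "n l > 0"
  shows "(\<Sum>x\<in>configurations n. tilted t n x * (scaled_sums n x $ l - c)\<^sup>2)
    \<le> 2 / real (n l) powr (1 / 2) + 2 * (real (n l) powr (1 / 4) * tanh t - c)\<^sup>2"
proof -
  define a where "a = real (n l) powr (3 / 4)"
  have a: "a > 0" using assms by (simp add: a_def)
  have quot: "real (n l) / a = real (n l) powr (1 / 4)"
    using assms powr_diff[of "real (n l)" 1 "3 / 4"] by (simp add: a_def)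
  have quot2: "real (n l) / a\<^sup>2 = 1 / real (n l) powr (1 / 2)"
    using assms powr_diff[of "real (n l)" 1 "3 / 2"] 
    by (simp add: a_def powr_power powr_minus_divide)
  let ?b = "real (n l) powr (1 / 4) * tanh t - c"
  have pt: "(scaled_sums n x $ l - c)\<^sup>2
      \<le> 2 * ((\<Sum>i=1..n l. x l i) - real (n l) * tanh t)\<^sup>2 / a\<^sup>2 + 2 * ?b\<^sup>2" for x
  proof -
    have sq: "(u + w)\<^sup>2 \<le> 2 * u\<^sup>2 + 2 * w\<^sup>2" for u w :: real
      using sum_squares_bound[of u w] by (simp add: power2_sum)
    have *: "scaled_sums n x $ l - c = ((\<Sum>i=1..n l. x l i) - real (n l) * tanh t) / a + ?b"
      by (simp add: scaled_sums_def diff_divide_distrib flip: quot a_def)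
    show ?thesis unfolding *
      using sq[of "((\<Sum>i=1..n l. x l i) - real (n l) * tanh t) / a" ?b] by (simp add: power_divide)
  qed
  have "(\<Sum>x\<in>configurations n. tilted t n x * (scaled_sums n x $ l - c)\<^sup>2)
    \<le> (\<Sum>x\<in>configurations n. tilted t n x *
         (2 * ((\<Sum>i=1..n l. x l i) - real (n l) * tanh t)\<^sup>2 / a\<^sup>2 + 2 * ?b\<^sup>2))"
    by (intro sum_mono mult_left_mono pt tilted_nonneg)
  also have "\<dots> = 2 / a\<^sup>2 * (\<Sum>x\<in>configurations n. tilted t n x *
         ((\<Sum>i=1..n l. x l i) - real (n l) * tanh t)\<^sup>2) + 2 * ?b\<^sup>2 * (\<Sum>x\<in>configurations n. tilted t n x)"
    by (simp add: sum_distrib_left sum_distrib_right distrib_left sum.distrib mult_ac)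
  also have "\<dots> \<le> 2 / a\<^sup>2 * real (n l) + 2 * ?b\<^sup>2 * 1"
    by (intro add_mono mult_left_mono tilted_variance_le) (auto simp: sum_tilted)
  also have "2 / a\<^sup>2 * real (n l) = 2 * (real (n l) / a\<^sup>2)" by simp
  finally show ?thesis unfolding quot2 by simp
qed

lemma scaled_tanh_tendsto:
  "(\<lambda>N. real N powr (1/4) * tanh (y / real N powr (1/4))) \<longlonglongrightarrow> y"
  by real_asymp

text \<open>For fixed \<open>y\<close> the scaled sums concentrate at one point. Continuity of
  \<open>f\<close> there, boundedness elsewhere and a second moment bound suffice.\<close>

lemma tilted_expectation_tendsto:
  fixes n :: "nat \<Rightarrow> 'm::finite \<Rightarrow> nat" and f :: "real^'m \<Rightarrow> real"
  assumes sizes: "\<And>l. filterlim (\<lambda>N. n N l) at_top sequentially"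
    and proportions: "\<And>l. (\<lambda>N. real (n N l) / real N) \<longlonglongrightarrow> \<alpha> l"
    and cont: "continuous_on UNIV f" and bound: "\<And>x. \<bar>f x\<bar> \<le> B"
  shows "(\<lambda>N. \<Sum>x\<in>configurations (n N). tilted (y / real N powr (1/4)) (n N) x
      * f (scaled_sums (n N) x)) \<longlonglongrightarrow> f (\<chi> l. \<alpha> l powr (1/4) * y)"
    (is "?E \<longlonglongrightarrow> f ?v")
proof (rule tendstoI)
  fix e :: real assume e: "e > 0"
  define t where "t N = y / real N powr (1/4)" for N
  define D where "D N l = 2 / real (n N l) powr (1/2)
    + 2 * (real (n N l) powr (1/4) * tanh (t N) - ?v $ l)\<^sup>2" for N l
  have B: "B \<ge> 0" using bound[of 0] by simp
  obtain d where d: "d > 0" "\<And>x. dist x ?v < d \<Longrightarrow> dist (f x) (f ?v) < e / 2"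
    using cont e unfolding continuous_on_iff by (metis UNIV_I half_gt_zero)
  \<comment> \<open>The pointwise form of Chebyshev's inequality: outside the ball of radius
    \<open>d\<close> the trivial bound \<open>2 * B\<close> is multiplied by the squared distance
    over \<open>d\<^sup>2\<close>, which is at least 1.\<close>
  have pt: "\<bar>f x - f ?v\<bar> \<le> e / 2 + 2 * B / d\<^sup>2 * (\<Sum>l\<in>UNIV. (x $ l - ?v $ l)\<^sup>2)" for x
  proof (cases "dist x ?v < d")
    case True
    then have "\<bar>f x - f ?v\<bar> \<le> e / 2" using d(2)[of x] by (simp add: dist_real_def)
    moreover have "0 \<le> 2 * B / d\<^sup>2 * (\<Sum>l\<in>UNIV. (x $ l - ?v $ l)\<^sup>2)"
      using B by (intro mult_nonneg_nonneg sum_nonneg) auto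
    ultimately show ?thesis by linarith
  next
    case False
    have "\<bar>f x - f ?v\<bar> \<le> 2 * B" using bound[of x] bound[of ?v] by linarith
    also have "\<dots> = 2 * B / d\<^sup>2 * d\<^sup>2" using d by simp
    also have "\<dots> \<le> 2 * B / d\<^sup>2 * (dist x ?v)\<^sup>2"
      using B d False by (intro mult_left_mono power_mono) auto
    also have "(dist x ?v)\<^sup>2 = (\<Sum>l\<in>UNIV. (x $ l - ?v $ l)\<^sup>2)"
      unfolding dist_vec_def by (simp add: L2_set_def sum_nonneg dist_real_def)
    finally show ?thesis using e by simp
  qed
  have D: "(\<lambda>N. D N l) \<longlonglongrightarrow> 0" for l
  proof -
    have "filterlim (\<lambda>N. real (n N l)) at_top sequentially"
      by (rule filterlim_compose[OF filterlim_real_sequentially sizes])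
    moreover have "((\<lambda>u::real. 2 / u powr (1/2)) \<longlongrightarrow> 0) at_top" by real_asymp
    ultimately have "(\<lambda>N. 2 / real (n N l) powr (1/2)) \<longlonglongrightarrow> 0"
      by (rule filterlim_compose[rotated])
    moreover have "(\<lambda>N. real (n N l) powr (1/4) * tanh (t N)) \<longlonglongrightarrow> \<alpha> l powr (1/4) * y"
    proof -
      \<comment> \<open>The group scale is the proportion times the global scale. The proportion may
        tend to 0; the positive exponent and nonnegative base keep the power continuous
        there.\<close>
      have "(\<lambda>N. (real (n N l) / real N) powr (1/4)
          * (real N powr (1/4) * tanh (y / real N powr (1/4)))) \<longlonglongrightarrow> \<alpha> l powr (1/4) * y"
        by (intro tendsto_mult scaled_tanh_tendsto tendsto_powr' proportions tendsto_const) auto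
      moreover have "\<forall>\<^sub>F N in sequentially. (real (n N l) / real N) powr (1/4)
          * (real N powr (1/4) * tanh (y / real N powr (1/4)))
          = real (n N l) powr (1/4) * tanh (t N)"
        using eventually_gt_at_top[of 0] by eventually_elim (simp add: powr_divide t_def)
      ultimately show ?thesis by (rule Lim_transform_eventually)
    qed
    then have "(\<lambda>N. 2 * (real (n N l) powr (1/4) * tanh (t N) - ?v $ l)\<^sup>2)
        \<longlonglongrightarrow> 2 * (\<alpha> l powr (1/4) * y - ?v $ l)\<^sup>2"
      by (intro tendsto_mult_left tendsto_power tendsto_diff tendsto_const)
    ultimately show ?thesis unfolding D_def using tendsto_add by fastforce
  qed
  have est: "\<bar>?E N - f ?v\<bar> \<le> e / 2 + 2 * B / d\<^sup>2 * (\<Sum>l\<in>UNIV. D N l)" if pos: "\<And>l. n N l > 0" for N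
  proof -
    let ?T = "tilted (t N) (n N)" and ?C = "configurations (n N)" and ?S = "scaled_sums (n N)"
    \<comment> \<open>The masses sum to 1, so the constant \<open>f ?v\<close> can be moved into the
      sum.\<close>
    have "?E N - f ?v = (\<Sum>x\<in>?C. ?T x * (f (?S x) - f ?v))"
      by (simp add: right_diff_distrib sum_subtractf sum_tilted t_def flip: sum_distrib_right)
    also have "\<bar>\<dots>\<bar> \<le> (\<Sum>x\<in>?C. \<bar>?T x * (f (?S x) - f ?v)\<bar>)" by (rule sum_abs)
    also have "\<dots> \<le> (\<Sum>x\<in>?C. ?T x * (e / 2 + 2 * B / d\<^sup>2 * (\<Sum>l\<in>UNIV. (?S x $ l - ?v $ l)\<^sup>2)))"
      unfolding abs_mult abs_of_nonneg[OF tilted_nonneg]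
      by (intro sum_mono mult_left_mono pt tilted_nonneg)
    also have "\<dots> = (\<Sum>x\<in>?C. ?T x) * (e / 2)
        + 2 * B / d\<^sup>2 * (\<Sum>x\<in>?C. \<Sum>l\<in>UNIV. ?T x * (?S x $ l - ?v $ l)\<^sup>2)"
      by (simp only: distrib_left sum.distrib sum_distrib_left sum_distrib_right mult_ac)
    also have "(\<Sum>x\<in>?C. \<Sum>l\<in>UNIV. ?T x * (?S x $ l - ?v $ l)\<^sup>2)
        = (\<Sum>l\<in>UNIV. \<Sum>x\<in>?C. ?T x * (?S x $ l - ?v $ l)\<^sup>2)" by (rule sum.swap)
    also have "(\<Sum>x\<in>?C. ?T x) * (e / 2) + 2 * B / d\<^sup>2 * \<dots> \<le> 1 * (e / 2) + 2 * B / d\<^sup>2 * (\<Sum>l\<in>UNIV. D N l)"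
      unfolding D_def using B pos
      by (intro add_mono mult_left_mono sum_mono tilted_deviation_le) (auto simp: sum_tilted)
    finally show ?thesis by simp
  qed
  have "(\<lambda>N. e / 2 + 2 * B / d\<^sup>2 * (\<Sum>l\<in>UNIV. D N l)) \<longlonglongrightarrow> e / 2 + 2 * B / d\<^sup>2 * (\<Sum>l\<in>(UNIV::'m set). 0)"
    by (intro tendsto_intros D)
  then have "\<forall>\<^sub>F N in sequentially. e / 2 + 2 * B / d\<^sup>2 * (\<Sum>l\<in>UNIV. D N l) < e"
    by (rule order_tendstoD) (use e in simp)
  moreover have "\<forall>\<^sub>F N in sequentially. \<forall>l. n N l > 0"
  proof (rule eventually_all_finite)
    fix l
    have "\<forall>\<^sub>F N in sequentially. 1 \<le> n N l"
      using sizes[of l] unfolding filterlim_at_top by blast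
    then show "\<forall>\<^sub>F N in sequentially. n N l > 0" by eventually_elim simp
  qed
  ultimately show "\<forall>\<^sub>F N in sequentially. dist (?E N) (f ?v) < e"
    by eventually_elim (use est in \<open>force simp: dist_real_def\<close>)
qed

section \<open>The model as a mixture of independent spins\<close>

text \<open>The Hubbard--Stratonovich transform: completing the square turns the quadratic interaction
  into a Gaussian mixture of product measures.\<close>

lemma tilted_mixture:
  fixes n :: "'m::finite \<Rightarrow> nat"
  assumes N: "(\<Sum>l\<in>UNIV. n l) = N" "N > 0"
  shows "has_bochner_integral lborel
      (\<lambda>y. mixing_weight N y * tilted (y / real N powr (1/4)) n x)
      (sqrt (2 * pi) / (real N powr (1/4) * 2 ^ N)
        * exp ((\<Sum>l\<in>UNIV. \<Sum>i=1..n l. x l i)\<^sup>2 / (2 * real N)))"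
proof -
  define a where "a = real N powr (1/4)"
  define s where "s = (\<Sum>l\<in>UNIV. \<Sum>i=1..n l. x l i)"
  have a: "a > 0" "a ^ 4 = real N" using N by (simp_all add: a_def powr_power)
  have sq: "sqrt (real N) = a\<^sup>2"
    using a by (intro real_sqrt_unique) (simp_all flip: power_mult)
  \<comment> \<open>The mass of a configuration depends on \<open>x\<close> only through the total
    spin \<open>s\<close>, and its denominator cancels the power of \<open>cosh\<close> in the
    mixing weight.\<close>
  have tilted: "tilted t n x = exp (t * s) / (2 * cosh t) ^ N" for t
  proof -
    have "tilted t n x = (\<Prod>l\<in>UNIV. exp (\<Sum>i=1..n l. t * x l i) / (2 * cosh t) ^ n l)"
      by (simp add: tilted_def spin_prob_def prod_dividef exp_sum)
    also have "\<dots> = exp (\<Sum>l\<in>UNIV. \<Sum>i=1..n l. t * x l i) / (2 * cosh t) ^ (\<Sum>l\<in>UNIV. n l)"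
      by (simp add: prod_dividef exp_sum power_sum)
    finally show ?thesis by (simp add: s_def sum_distrib_left N)
  qed
  \<comment> \<open>Completing the square exposes a normal density with mean
    \<open>s / a ^ 3\<close> and standard deviation \<open>1 / a\<close>; the remainder
    \<open>s\<^sup>2 / (2 * N)\<close> is the Curie-Weiss exponent.\<close>
  have "mixing_weight N y * tilted (y / a) n x
    = sqrt (2 * pi) / (a * 2 ^ N) * exp (s\<^sup>2 / (2 * real N)) * normal_density (s / a ^ 3) (1 / a) y" for y
  proof -
    have "mixing_weight N y * tilted (y / a) n x = exp (- (a\<^sup>2 * y\<^sup>2 / 2) + y / a * s) / 2 ^ N"
      unfolding tilted mixing_weight_def sq a_def[symmetric]
      by (simp add: power_mult_distrib flip: exp_add)
    also have "- (a\<^sup>2 * y\<^sup>2 / 2) + y / a * s = s\<^sup>2 / (2 * real N) + - (y - s / a ^ 3)\<^sup>2 / (2 * (1 / a)\<^sup>2)"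
      using a(1) unfolding a(2)[symmetric]
      by (simp add: field_simps power2_eq_square power3_eq_cube power4_eq_xxxx)
    finally show ?thesis
      using a(1) unfolding exp_add normal_density_def
      by (simp add: real_sqrt_divide real_sqrt_mult)
  qed
  moreover have "has_bochner_integral lborel
      (\<lambda>y. sqrt (2 * pi) / (a * 2 ^ N) * exp (s\<^sup>2 / (2 * real N)) * normal_density (s / a ^ 3) (1 / a) y)
      (sqrt (2 * pi) / (a * 2 ^ N) * exp (s\<^sup>2 / (2 * real N)) * 1)"
    using a(1) by (intro has_bochner_integral_mult_right) (simp add: has_bochner_integral_iff)
  ultimately show ?thesis by (simp add: a_def s_def)
qed

lemma cw_weight_homogeneous:
  assumes "homogeneous 1 J"
  shows "cw_weight J n x
    = exp ((\<Sum>l\<in>UNIV. \<Sum>i=1..n l. x l i)\<^sup>2 / (2 * real (\<Sum>l\<in>UNIV. n l)))"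
proof -
  have "(\<Sum>l\<in>UNIV. \<Sum>k\<in>UNIV. J $ l $ k * (\<Sum>i=1..n l. \<Sum>j=1..n k. x l i * x k j))
    = (\<Sum>l\<in>UNIV. \<Sum>i=1..n l. x l i)\<^sup>2"
    using assms by (simp add: homogeneous_def power2_eq_square sum_product)
  then show ?thesis by (simp add: cw_weight_def)
qed

text \<open>Linearity over the finite set of configurations. The choice \<open>F = 1\<close> yields
  the partition function, and a function of the scaled sums yields the numerator of its
  expectation.\<close>

lemma curie_weiss_sum_mixture:
  fixes n :: "'m::finite \<Rightarrow> nat"
  assumes "homogeneous 1 J" "(\<Sum>l\<in>UNIV. n l) = N" "N > 0"
  shows "has_bochner_integral lborel
      (\<lambda>y. mixing_weight N y * (\<Sum>x\<in>configurations n. tilted (y / real N powr (1/4)) n x * F x))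
      (sqrt (2 * pi) / (real N powr (1/4) * 2 ^ N) * (\<Sum>x\<in>configurations n. cw_weight J n x * F x))"
proof -
  have "has_bochner_integral lborel
      (\<lambda>y. \<Sum>x\<in>configurations n. mixing_weight N y * tilted (y / real N powr (1/4)) n x * F x)
      (\<Sum>x\<in>configurations n. sqrt (2 * pi) / (real N powr (1/4) * 2 ^ N)
        * exp ((\<Sum>l\<in>UNIV. \<Sum>i=1..n l. x l i)\<^sup>2 / (2 * real N)) * F x)"
    using tilted_mixture[OF assms(2,3)]
    by (intro has_bochner_integral_sum has_bochner_integral_mult_left) auto
  then show ?thesis
    by (simp add: sum_distrib_left mult.assoc cw_weight_homogeneous[OF assms(1)] assms(2))
qed

text \<open>The events \<open>A x\<close> for configurations \<open>x\<close> partition the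
  probability space, so the expectation is a finite sum over their known probabilities.\<close>

lemma curie_weiss_expectation:
  fixes n :: "'m::finite \<Rightarrow> nat" and f :: "real^'m \<Rightarrow> real"
  assumes "curie_weiss_model J n P X"
  shows "(\<integral>\<omega>. f (scaled_sums n (\<lambda>l i. X l i \<omega>)) \<partial>P)
    = (\<Sum>x\<in>configurations n. cw_weight J n x * f (scaled_sums n x)) / cw_partition J n"
proof -
  interpret prob_space P using assms by (simp add: curie_weiss_model_def)
  define A where "A x = {\<omega> \<in> space P. \<forall>l. \<forall>i\<in>{1..n l}. X l i \<omega> = x l i}" for x
  have meas: "X l i \<in> borel_measurable P" if "i \<in> {1..n l}" for l i
    using assms that by (simp add: curie_weiss_model_def)
  have A_sets: "A x \<in> sets P" for x
  proof -
    have ev: "{\<omega> \<in> space P. X l i \<omega> = x l i} \<in> sets P" if "i \<in> {1..n l}" for l i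
      using measurable_sets[OF meas[OF that], of "{x l i}"]
      by (simp add: vimage_def Int_def conj_commute)
    have "{\<omega> \<in> space P. \<forall>l\<in>UNIV. \<forall>i\<in>{1..n l}. X l i \<omega> = x l i} \<in> sets P"
      by (intro sets.sets_Collect_finite_All ev) auto
    then show ?thesis by (simp add: A_def)
  qed
  have A_prob: "measure P (A x) = cw_weight J n x / cw_partition J n" if "x \<in> configurations n" for x
    using assms that by (simp add: curie_weiss_model_def A_def)
  have split: "f (scaled_sums n (\<lambda>l i. X l i \<omega>))
      = (\<Sum>x\<in>configurations n. f (scaled_sums n x) * indicator (A x) \<omega>)" if \<omega>: "\<omega> \<in> space P" for \<omega>
  proof -
    \<comment> \<open>Restriction makes the realised spins extensional, so that they form the one
      configuration \<open>x\<close> with \<open>\<omega> \<in> A x\<close>.\<close>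
    define x0 where "x0 l = restrict (\<lambda>i. X l i \<omega>) {1..n l}" for l
    have "X l i \<omega> \<in> {-1, 1}" if "i \<in> {1..n l}" for l i
      using assms \<omega> that unfolding curie_weiss_model_def by blast
    then have x0: "x0 \<in> configurations n"
      by (simp add: configurations_def x0_def PiE_iff)
    have "\<omega> \<in> A x \<longleftrightarrow> x = x0" if "x \<in> configurations n" for x
    proof
      assume "\<omega> \<in> A x"
      then have "x l i = x0 l i" for l i
        using that by (cases "i \<in> {1..n l}")
          (auto simp: A_def x0_def configurations_def PiE_iff extensional_def restrict_def)
      then show "x = x0" by blast
    qed (use \<omega> in \<open>auto simp: A_def x0_def\<close>)
    then have "(\<Sum>x\<in>configurations n. f (scaled_sums n x) * indicator (A x) \<omega>)
      = (\<Sum>x\<in>configurations n. if x = x0 then f (scaled_sums n x0) else 0)"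
      by (intro sum.cong refl) (auto simp: indicator_def)
    also have "\<dots> = f (scaled_sums n x0)" using x0 by (simp add: finite_configurations)
    also have "scaled_sums n x0 = scaled_sums n (\<lambda>l i. X l i \<omega>)"
      by (simp add: scaled_sums_def x0_def)
    finally show ?thesis by simp
  qed
  have "(\<integral>\<omega>. f (scaled_sums n (\<lambda>l i. X l i \<omega>)) \<partial>P)
    = (\<integral>\<omega>. (\<Sum>x\<in>configurations n. f (scaled_sums n x) * indicator (A x) \<omega>) \<partial>P)"
    by (rule Bochner_Integration.integral_cong[OF refl split])
  also have "\<dots> = (\<Sum>x\<in>configurations n. f (scaled_sums n x) * measure P (A x))"
    using A_sets by (subst Bochner_Integration.integral_sum) (auto simp: emeasure_eq_measure)
  also have "\<dots> = (\<Sum>x\<in>configurations n. cw_weight J n x * f (scaled_sums n x)) / cw_partition J n"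
    by (simp add: A_prob sum_divide_distrib mult.commute)
  finally show ?thesis .
qed

text \<open>Numerator and partition function carry the same prefactor \<open>c\<close>, which
  cancels in the quotient.\<close>

lemma curie_weiss_expectation_mixture:
  fixes n :: "'m::finite \<Rightarrow> nat" and f :: "real^'m \<Rightarrow> real"
  assumes model: "curie_weiss_model J n P X" and J: "homogeneous 1 J"
    and N: "(\<Sum>l\<in>UNIV. n l) = N" "N > 0"
  shows "(\<integral>\<omega>. f (scaled_sums n (\<lambda>l i. X l i \<omega>)) \<partial>P)
    = (\<integral>y. mixing_weight N y * (\<Sum>x\<in>configurations n. tilted (y / real N powr (1/4)) n x
          * f (scaled_sums n x)) \<partial>lborel) / (\<integral>y. mixing_weight N y \<partial>lborel)"
proof -
  define c where "c = sqrt (2 * pi) / (real N powr (1/4) * 2 ^ N)"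
  have c: "c > 0" using N by (simp add: c_def)
  note mix = curie_weiss_sum_mixture[OF J N, folded c_def, THEN has_bochner_integral_integral_eq]
  have "(\<integral>y. mixing_weight N y \<partial>lborel) = c * cw_partition J n"
    using mix[of "\<lambda>_. 1"] by (simp add: sum_tilted cw_partition_def)
  then show ?thesis
    using c by (simp add: mix curie_weiss_expectation[OF model])
qed

section \<open>Moments of the quartic density\<close>

text \<open>The substitution \<open>u = y ^ 4 / 12\<close> in the Gamma integral with parameter
  \<open>s = (k + 1) / 4\<close>.\<close>

lemma has_integral_quartic_moment:
  fixes k :: nat
  shows "((\<lambda>y. y ^ k * exp (- (y ^ 4 / 12))) has_integral
      12 powr (real (k + 1) / 4) * Gamma (real (k + 1) / 4) / 4) {0..}"
proof -
  define s where "s = real (k + 1) / 4"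
  have s: "s > 0" by (simp add: s_def)
  define f where "f = (\<lambda>u::real. u powr (s - 1) / exp u)"
  \<comment> \<open>Dropping the endpoint 0 is harmless for the integral and gives access to the
    power laws for positive arguments.\<close>
  have spike: "(h has_integral r) {0..} \<longleftrightarrow> (h has_integral r) {0<..}" for h :: "real \<Rightarrow> real" and r
  proof (rule has_integral_spike_set_eq)
    show "negligible {x \<in> {0..} - {0<..}. h x \<noteq> 0}"
      by (rule negligible_subset[of "{0}"]) auto
    show "negligible {x \<in> {0<..} - {0..}. h x \<noteq> 0}"
      by (rule negligible_subset[of "{}"]) auto
  qed
  have f: "(f has_integral Gamma s) {0<..}"
    using Gamma_integral_real[OF s] unfolding spike f_def .
  then have "f absolutely_integrable_on {0<..}"
    by (intro nonnegative_absolutely_integrable_1) (auto simp: f_def integrable_on_def)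
  moreover have "(\<lambda>y::real. y ^ 4 / 12) ` {0<..} = {0<..}"
  proof (intro equalityI subsetI)
    fix u :: real assume "u \<in> {0<..}"
    then have "u = ((12 * u) powr (1/4)) ^ 4 / 12" "(12 * u) powr (1/4) > 0"
      by (simp_all add: powr_power)
    then show "u \<in> (\<lambda>y::real. y ^ 4 / 12) ` {0<..}" by (intro rev_image_eqI[of _ _ u]) simp_all
  qed auto
  ultimately have "f absolutely_integrable_on (\<lambda>y::real. y ^ 4 / 12) ` {0<..} \<and>
      integral ((\<lambda>y::real. y ^ 4 / 12) ` {0<..}) f = Gamma s"
    using f by (simp add: integral_unique)
  moreover have "inj_on (\<lambda>y::real. y ^ 4 / 12) {0<..}"
    by (rule inj_onI, rule power_eq_imp_eq_base[of _ 4]) auto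
  moreover have der: "((\<lambda>y. y ^ 4 / 12) has_field_derivative y ^ 3 / 3) (at y within {0<..})" for y :: real
    by (rule derivative_eq_intros refl | simp)+
  ultimately have "(\<lambda>y. \<bar>y ^ 3 / 3\<bar> * f (y ^ 4 / 12)) absolutely_integrable_on {0<..} \<and>
      integral {0<..} (\<lambda>y. \<bar>y ^ 3 / 3\<bar> * f (y ^ 4 / 12)) = Gamma s"
    by (subst has_absolute_integral_change_of_variables_1'[where g = "\<lambda>y. y ^ 4 / 12"])
       (simp_all add: der)
  then have "((\<lambda>y. \<bar>y ^ 3 / 3\<bar> * f (y ^ 4 / 12)) has_integral Gamma s) {0<..}"
    by (simp add: has_integral_iff set_lebesgue_integral_eq_integral(1))
  \<comment> \<open>The substituted integrand is \<open>4 / 12 powr s\<close> times the wanted one,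
    the 4 coming from 12 divided by the 3 in the derivative \<open>y ^ 3 / 3\<close>.\<close>
  then have *: "((\<lambda>y. \<bar>y ^ 3 / 3\<bar> * f (y ^ 4 / 12) * (12 powr s / 4))
      has_integral Gamma s * (12 powr s / 4)) {0<..}"
    by (rule has_integral_mult_left)
  have "((\<lambda>y. y ^ k * exp (- (y ^ 4 / 12))) has_integral Gamma s * (12 powr s / 4)) {0<..}"
  proof (rule has_integral_eq[OF _ *])
    fix y :: real assume "y \<in> {0<..}"
    then have y: "y > 0" by simp
    have "(y ^ 4) powr (s - 1) = (y powr real 4) powr (s - 1)"
      by (subst powr_realpow[OF y]) (rule refl)
    also have "\<dots> = y powr (real k - real 3)"
    proof -
      have "real 4 * (s - 1) = real k - real 3" by (simp add: s_def right_diff_distrib)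
      then show ?thesis unfolding powr_powr by simp
    qed
    also have "\<dots> = y ^ k / y ^ 3"
      unfolding powr_diff powr_realpow[OF y] ..
    finally have "(y ^ 4 / 12) powr (s - 1) = y ^ k / y ^ 3 / 12 powr (s - 1)"
      using y by (simp add: powr_divide)
    also have "12 powr (s - 1) = 12 powr s / 12" by (simp add: powr_diff)
    finally show "\<bar>y ^ 3 / 3\<bar> * f (y ^ 4 / 12) * (12 powr s / 4) = y ^ k * exp (- (y ^ 4 / 12))"
      using y by (simp add: f_def exp_minus field_simps)
  qed
  then have "((\<lambda>y. y ^ k * exp (- (y ^ 4 / 12))) has_integral Gamma s * (12 powr s / 4)) {0..}"
    unfolding spike .
  then show ?thesis by (simp add: s_def mult_ac)
qed

text \<open>Nonnegativity on the half-line turns the gauge integral into a Lebesgue integral and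
  gives integrability. The indicator form fits the reflection rules for even and odd
  integrands.\<close>

lemma quartic_half_moment:
  fixes k :: nat
  shows "has_bochner_integral lborel (\<lambda>y. indicator {0..} y *\<^sub>R (y ^ k * exp (- (y ^ 4 / 12))))
      (12 powr (real (k + 1) / 4) * Gamma (real (k + 1) / 4) / 4)"
proof (rule has_bochner_integral_nn_integral)
  show "(\<integral>\<^sup>+ y. ennreal (indicator {0..} y *\<^sub>R (y ^ k * exp (- (y ^ 4 / 12)))) \<partial>lborel)
    = ennreal (12 powr (real (k + 1) / 4) * Gamma (real (k + 1) / 4) / 4)"
    unfolding real_scaleR_def
    by (rule nn_integral_has_integral_lebesgue[OF _ has_integral_quartic_moment]) auto
qed (auto simp: indicator_def intro!: Gamma_real_nonneg)

lemma quartic_moment: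
  fixes k :: nat
  shows "has_bochner_integral lborel (\<lambda>y. y ^ k * exp (- (y ^ 4 / 12)))
      (if even k then 12 powr (real (k + 1) / 4) * Gamma (real (k + 1) / 4) / 2 else 0)"
proof (cases "even k")
  case True
  then show ?thesis
    using has_bochner_integral_even_function[OF quartic_half_moment[of k]]
    by (simp add: mult.commute)
next
  case False
  then show ?thesis
    using has_bochner_integral_odd_function[OF quartic_half_moment[of k]] by simp
qed

text \<open>A multiple of the centred normal density of variance 24. It supplies the dominating
  functions for the limit theorem.\<close>

lemma integrable_gaussian_bound: "integrable lborel (\<lambda>y::real. exp (1/12 - y\<^sup>2 / 48))"
proof -
  have "(\<lambda>y::real. exp (1/12 - y\<^sup>2 / 48))
      = (\<lambda>y. exp (1/12) * sqrt (2 * pi * 24) * normal_density 0 (sqrt 24) y)"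
    by (simp add: normal_density_def fun_eq_iff exp_diff exp_minus inverse_eq_divide)
  then show ?thesis by simp
qed

section \<open>The quartic probability law\<close>

text \<open>The moment of order 0 in \<open>quartic_moment\<close>, that is, the total mass of
  \<open>exp (- (y ^ 4 / 12))\<close>.\<close>

definition quartic_norm :: real where
  "quartic_norm = 12 powr (1/4) * Gamma (1/4) / 2"

definition quartic_law :: "real measure" where
  "quartic_law = density lborel (\<lambda>y. ennreal (exp (- (y ^ 4 / 12)) / quartic_norm))"

lemma quartic_norm_pos: "0 < quartic_norm"
  by (simp add: quartic_norm_def Gamma_real_pos)

lemma has_bochner_integral_quartic_norm:
  "has_bochner_integral lborel (\<lambda>y::real. exp (- (y ^ 4 / 12))) quartic_norm"
  using quartic_moment[of 0] by (simp add: quartic_norm_def)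

lemma sets_quartic_law [simp, measurable_cong]: "sets quartic_law = sets borel"
  by (simp add: quartic_law_def)

lemma prob_space_quartic_law: "prob_space quartic_law"
proof (rule prob_spaceI)
  have int: "has_bochner_integral lborel (\<lambda>y. exp (- (y ^ 4 / 12)) / quartic_norm) (quartic_norm / quartic_norm)"
    by (intro has_bochner_integral_divide_zero has_bochner_integral_quartic_norm)
  have "emeasure quartic_law (space quartic_law)
      = (\<integral>\<^sup>+ y. ennreal (exp (- (y ^ 4 / 12)) / quartic_norm) \<partial>lborel)"
    unfolding quartic_law_def by (simp add: emeasure_density)
  also have "\<dots> = ennreal (\<integral>y. exp (- (y ^ 4 / 12)) / quartic_norm \<partial>lborel)"
    using int quartic_norm_pos by (intro nn_integral_eq_integral) (auto simp: has_bochner_integral_iff)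
  also have "(\<integral>y. exp (- (y ^ 4 / 12)) / quartic_norm \<partial>lborel) = 1"
    unfolding has_bochner_integral_integral_eq[OF int] using quartic_norm_pos by simp
  finally show "emeasure quartic_law (space quartic_law) = 1" by simp
qed

lemma has_bochner_integral_quartic_law:
  fixes f :: "real \<Rightarrow> real"
  assumes [measurable]: "f \<in> borel_measurable borel"
    and int: "has_bochner_integral lborel (\<lambda>y. exp (- (y ^ 4 / 12)) * f y) r"
  shows "has_bochner_integral quartic_law f (r / quartic_norm)"
  unfolding quartic_law_def
proof (rule has_bochner_integral_density)
  show "has_bochner_integral lborel (\<lambda>y. (exp (- (y ^ 4 / 12)) / quartic_norm) *\<^sub>R f y) (r / quartic_norm)"
    using has_bochner_integral_divide_zero[OF int, of quartic_norm] by simp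
qed (use quartic_norm_pos in auto)

lemma quartic_law_moment:
  "has_bochner_integral quartic_law (\<lambda>y. y ^ k)
    (if even k then 12 powr (real k / 4) * (Gamma ((real k + 1) / 4) / Gamma (1 / 4)) else 0)"
proof -
  have mom: "has_bochner_integral lborel (\<lambda>y. exp (- (y ^ 4 / 12)) * y ^ k)
      (if even k then 12 powr (real (k + 1) / 4) * Gamma (real (k + 1) / 4) / 2 else 0)"
    using quartic_moment[of k] by (simp only: mult.commute[of "exp _"])
  have "real (k + 1) / 4 = real k / 4 + 1 / 4" by simp
  then have "(12::real) powr (real (k + 1) / 4) = 12 powr (real k / 4) * 12 powr (1 / 4)"
    by (simp only: powr_add)
  then have "(if even k then 12 powr (real (k + 1) / 4) * Gamma (real (k + 1) / 4) / 2 else 0) / quartic_norm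
    = (if even k then 12 powr (real k / 4) * (Gamma ((real k + 1) / 4) / Gamma (1 / 4)) else 0)"
    by (simp add: quartic_norm_def add.commute)
  then show ?thesis
    using has_bochner_integral_quartic_law[OF _ mom] by simp
qed

section \<open>The limit law on the ray and weak convergence\<close>

lemma measurable_ray [measurable]:
  "(\<lambda>y. \<chi> l. \<alpha> l powr (1/4) * y) \<in> borel \<rightarrow>\<^sub>M (borel :: (real^'m::finite) measure)"
  by (intro borel_measurable_continuous_onI continuous_intros)

text \<open>For \<open>k = 0\<close> both sides are 1, also at \<open>a = 0\<close>, which is the
  case that calls for \<open>pow0\<close>.\<close>

lemma powr_quarter_power:
  assumes "a \<ge> 0"
  shows "(a powr (1/4)) ^ k = pow0 a (real k / 4)"
proof (cases "k = 0")
  case False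
  then show ?thesis using assms
    by (cases "a = 0") (simp_all add: pow0_def powr_power)
qed (simp add: pow0_def)

theorem theorem15:
  fixes J :: "real^'m^'m"
    and n :: "nat \<Rightarrow> 'm::finite \<Rightarrow> nat"
    and \<alpha> :: "'m \<Rightarrow> real"
    and P :: "nat \<Rightarrow> 'a measure"
    and X :: "nat \<Rightarrow> 'm \<Rightarrow> nat \<Rightarrow> 'a \<Rightarrow> real"
  assumes group_sizes: "\<And>N. N \<ge> CARD('m) \<Longrightarrow> (\<Sum>l\<in>UNIV. n N l) = N"
    and sizes_at_top: "\<And>l. filterlim (\<lambda>N. n N l) at_top at_top"
    and proportions: "\<And>l. (\<lambda>N. real (n N l) / real N) \<longlonglongrightarrow> \<alpha> l"
    and alpha_nonneg: "\<And>l. \<alpha> l \<ge> 0"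
    and alpha_sum: "(\<Sum>l\<in>UNIV. \<alpha> l) = 1"
    and coupling: "coupling_matrix J"
    and critical: "homogeneous 1 J"
    and model: "\<And>N. N \<ge> CARD('m) \<Longrightarrow> curie_weiss_model J (n N) (P N) (X N)"
  shows "\<exists>\<mu> :: (real^'m) measure.
           prob_space \<mu> \<and> sets \<mu> = sets borel \<and>
           converges_weakly
             (\<lambda>N. distr (P N) borel
                (\<lambda>\<omega>. \<chi> l. group_sum (n N) (X N) l \<omega> / real (n N l) powr (3 / 4))) \<mu> \<and>
           (\<forall>K :: 'm \<Rightarrow> nat.
              integrable \<mu> (\<lambda>x. \<Prod>l\<in>UNIV. (x $ l) ^ K l) \<and>
              moment \<mu> K =
                (if even (\<Sum>l\<in>UNIV. K l)
                 then 12 powr (real (\<Sum>l\<in>UNIV. K l) / 4)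
                        * (Gamma ((real (\<Sum>l\<in>UNIV. K l) + 1) / 4) / Gamma (1 / 4))
                        * (\<Prod>l\<in>UNIV. pow0 (\<alpha> l) (real (K l) / 4))
                 else 0))"
proof -
  define V :: "real \<Rightarrow> real^'m" where "V y = (\<chi> l. \<alpha> l powr (1/4) * y)" for y
  define \<mu> where "\<mu> = distr quartic_law borel V"
  have V [measurable]: "V \<in> borel_measurable borel" unfolding V_def by (rule measurable_ray)
  have V': "V \<in> borel_measurable quartic_law" by measurable
  have prob: "prob_space \<mu>"
    unfolding \<mu>_def by (rule prob_space.prob_space_distr[OF prob_space_quartic_law V'])
  have moments: "integrable \<mu> (\<lambda>x. \<Prod>l\<in>UNIV. (x $ l) ^ K l) \<and>
      moment \<mu> K = (if even (\<Sum>l\<in>UNIV. K l)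
        then 12 powr (real (\<Sum>l\<in>UNIV. K l) / 4)
               * (Gamma ((real (\<Sum>l\<in>UNIV. K l) + 1) / 4) / Gamma (1 / 4))
               * (\<Prod>l\<in>UNIV. pow0 (\<alpha> l) (real (K l) / 4))
        else 0)" for K :: "'m \<Rightarrow> nat"
  proof -
    have meas: "(\<lambda>x::real^'m. \<Prod>l\<in>UNIV. (x $ l) ^ K l) \<in> borel_measurable borel"
      by (intro borel_measurable_continuous_onI continuous_intros)
    \<comment> \<open>On the ray a monomial is a constant times a power of \<open>y\<close>, so only
      one-dimensional moments enter.\<close>
    have eq: "(\<Prod>l\<in>UNIV. (V y $ l) ^ K l)
        = (\<Prod>l\<in>UNIV. pow0 (\<alpha> l) (real (K l) / 4)) * y ^ (\<Sum>l\<in>UNIV. K l)" for y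
      using alpha_nonneg
      by (simp add: V_def power_mult_distrib prod.distrib power_sum powr_quarter_power)
    show ?thesis
      unfolding moment_def \<mu>_def integrable_distr_eq[OF V' meas] integral_distr[OF V' meas] eq
      using quartic_law_moment[of "\<Sum>l\<in>UNIV. K l"] by (simp add: has_bochner_integral_iff mult.commute)
  qed
  have conv: "(\<lambda>N. integral\<^sup>L (distr (P N) borel
      (\<lambda>\<omega>. \<chi> l. group_sum (n N) (X N) l \<omega> / real (n N l) powr (3 / 4))) f) \<longlonglongrightarrow> integral\<^sup>L \<mu> f"
    if cont: "continuous_on UNIV f" and bdd: "bounded (range f)" for f :: "real^'m \<Rightarrow> real"
  proof -
    \<comment> \<open>The hypotheses on sizes and model hold from \<open>CARD('m)\<close> on.
      Shifting the index by \<open>c\<close> makes each of them available and the population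
      positive; \<open>LIMSEQ_offset\<close> undoes the shift.\<close>
    define c where "c = CARD('m)"
    have c: "i + c > 0" "i + c \<ge> CARD('m)" for i by (simp_all add: c_def)
    obtain B where B: "\<And>x. \<bar>f x\<bar> \<le> B" using bdd by (auto simp: bounded_iff)
    have f_meas [measurable]: "f \<in> borel_measurable borel"
      by (rule borel_measurable_continuous_onI[OF cont])
    define E where "E N y = (\<Sum>x\<in>configurations (n N).
      tilted (y / real N powr (1/4)) (n N) x * f (scaled_sums (n N) x))" for N y
    have E_bound: "\<bar>E N y\<bar> \<le> B" for N y
    proof -
      have "\<bar>E N y\<bar> \<le> (\<Sum>x\<in>configurations (n N). \<bar>tilted (y / real N powr (1/4)) (n N) x
          * f (scaled_sums (n N) x)\<bar>)"
        unfolding E_def by (rule sum_abs)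
      also have "\<dots> \<le> (\<Sum>x\<in>configurations (n N). tilted (y / real N powr (1/4)) (n N) x * B)"
        unfolding abs_mult abs_of_nonneg[OF tilted_nonneg]
        by (intro sum_mono mult_left_mono B tilted_nonneg)
      also have "\<dots> = B" by (simp add: sum_tilted flip: sum_distrib_right)
      finally show ?thesis .
    qed
    have B0: "0 \<le> B" using B[of 0] by linarith
    have E_lim: "(\<lambda>N. E N y) \<longlonglongrightarrow> f (V y)" for y
      unfolding E_def V_def
      by (rule tilted_expectation_tendsto[OF sizes_at_top proportions cont B])
    have mixing_meas: "(\<lambda>y. mixing_weight (i + c) y) \<in> borel_measurable lborel" for i
      unfolding mixing_weight_def cosh_field_def by measurable
    \<comment> \<open>Measurability in \<open>y\<close> is inherited from the integrability of the
      mixture.\<close>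
    have E_meas: "(\<lambda>y. mixing_weight (i + c) y * E (i + c) y) \<in> borel_measurable lborel" for i
      using curie_weiss_sum_mixture[OF critical group_sizes[OF c(2)] c(1),
          THEN borel_measurable_has_bochner_integral]
      unfolding E_def .
    \<comment> \<open>Dominated convergence: the weights are below a Gaussian uniformly in the
      population size, and \<open>E\<close> is an average of values of \<open>f\<close>, hence
      bounded by \<open>B\<close>.\<close>
    have num: "(\<lambda>i. \<integral>y. mixing_weight (i + c) y * E (i + c) y \<partial>lborel)
        \<longlonglongrightarrow> (\<integral>y. exp (- (y ^ 4 / 12)) * f (V y) \<partial>lborel)"
    proof (rule integral_dominated_convergence[where w = "\<lambda>y. exp (1/12 - y\<^sup>2 / 48) * B"])
      show "integrable lborel (\<lambda>y::real. exp (1/12 - y\<^sup>2 / 48) * B)"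
        using integrable_gaussian_bound by simp
      show "AE y in lborel. (\<lambda>i. mixing_weight (i + c) y * E (i + c) y) \<longlonglongrightarrow> exp (- (y ^ 4 / 12)) * f (V y)"
        by (intro AE_I2 tendsto_mult LIMSEQ_ignore_initial_segment mixing_weight_tendsto E_lim)
      show "AE y in lborel. norm (mixing_weight (i + c) y * E (i + c) y) \<le> exp (1/12 - y\<^sup>2 / 48) * B" for i
        by (intro AE_I2) (auto simp: abs_mult less_imp_le[OF mixing_weight_pos]
            intro!: mult_mono mixing_weight_le E_bound c(1))
    qed (use E_meas in measurable)
    have den: "(\<lambda>i. \<integral>y. mixing_weight (i + c) y \<partial>lborel) \<longlonglongrightarrow> (\<integral>y. exp (- (y ^ 4 / 12)) \<partial>lborel)"
    proof (rule integral_dominated_convergence[where w = "\<lambda>y. exp (1/12 - y\<^sup>2 / 48)"])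
      show "AE y in lborel. (\<lambda>i. mixing_weight (i + c) y) \<longlonglongrightarrow> exp (- (y ^ 4 / 12))"
        by (intro AE_I2 LIMSEQ_ignore_initial_segment mixing_weight_tendsto)
      show "AE y in lborel. norm (mixing_weight (i + c) y) \<le> exp (1/12 - y\<^sup>2 / 48)" for i
        by (intro AE_I2) (auto simp: less_imp_le[OF mixing_weight_pos]
            intro!: mixing_weight_le c(1))
    qed (use mixing_meas integrable_gaussian_bound in auto)
    have "integrable lborel (\<lambda>y. exp (- (y ^ 4 / 12)) * f (V y))"
    proof (rule Bochner_Integration.integrable_bound)
      show "integrable lborel (\<lambda>y::real. exp (- (y ^ 4 / 12)) * B)"
        using has_bochner_integral_quartic_norm by (auto simp: has_bochner_integral_iff)
      show "AE y in lborel. norm (exp (- (y ^ 4 / 12)) * f (V y)) \<le> norm (exp (- (y ^ 4 / 12)) * B)"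
        using B B0 by (intro AE_I2) (simp add: abs_mult)
    qed measurable
    then have limit: "(\<integral>y. exp (- (y ^ 4 / 12)) * f (V y) \<partial>lborel) / quartic_norm = integral\<^sup>L \<mu> f"
      unfolding \<mu>_def integral_distr[OF V' f_meas]
      by (intro has_bochner_integral_integral_eq[symmetric] has_bochner_integral_quartic_law
          has_bochner_integral_integrable) measurable
    \<comment> \<open>Numerator and denominator converge separately, and the limit
      \<open>quartic_norm\<close> of the latter is positive.\<close>
    have "(\<lambda>i. (\<integral>y. mixing_weight (i + c) y * E (i + c) y \<partial>lborel) / (\<integral>y. mixing_weight (i + c) y \<partial>lborel))
        \<longlonglongrightarrow> integral\<^sup>L \<mu> f"
      using tendsto_divide[OF num den] quartic_norm_pos
      by (simp add: has_bochner_integral_integral_eq[OF has_bochner_integral_quartic_norm] limit)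
    also have "(\<lambda>i. (\<integral>y. mixing_weight (i + c) y * E (i + c) y \<partial>lborel) / (\<integral>y. mixing_weight (i + c) y \<partial>lborel))
        = (\<lambda>i. integral\<^sup>L (distr (P (i + c)) borel (\<lambda>\<omega>. \<chi> l. group_sum (n (i + c)) (X (i + c)) l \<omega>
            / real (n (i + c) l) powr (3 / 4))) f)"
    proof
      fix i
      let ?N = "i + c"
      let ?T = "\<lambda>\<omega>. scaled_sums (n ?N) (\<lambda>l j. X ?N l j \<omega>)"
      have T: "(\<lambda>\<omega>. \<chi> l. group_sum (n ?N) (X ?N) l \<omega> / real (n ?N l) powr (3 / 4)) = ?T"
        by (simp add: scaled_sums_def group_sum_def fun_eq_iff)
      have "?T \<in> borel_measurable (P ?N)"
      proof -
        have [measurable]: "X ?N l j \<in> borel_measurable (P ?N)" if "j \<in> {1..n ?N l}" for l j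
          using model[OF c(2)[of i]] that by (simp add: curie_weiss_model_def)
        have "(\<lambda>\<omega>. (\<Sum>j=1..n ?N l. X ?N l j \<omega>) / real (n ?N l) powr (3 / 4)) \<in> borel_measurable (P ?N)" for l
          by measurable
        then show ?thesis
          unfolding scaled_sums_def
          by (subst borel_measurable_euclidean_space)
             (auto simp: Basis_vec_def inner_axis)
      qed
      then show "(\<integral>y. mixing_weight ?N y * E ?N y \<partial>lborel) / (\<integral>y. mixing_weight ?N y \<partial>lborel)
        = integral\<^sup>L (distr (P ?N) borel (\<lambda>\<omega>. \<chi> l. group_sum (n ?N) (X ?N) l \<omega>
            / real (n ?N l) powr (3 / 4))) f"
        unfolding T E_def
        by (simp add: integral_distr
            curie_weiss_expectation_mixture[OF model[OF c(2)] critical group_sizes[OF c(2)] c(1)])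
    qed
    finally show ?thesis by (rule LIMSEQ_offset)
  qed
  show ?thesis
    using prob moments conv by (intro exI[of _ \<mu>]) (auto simp: converges_weakly_def \<mu>_def)
qed

end
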